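(* Let $\alpha,\beta,\varepsilon>0$, $T_{\rm m}\in\mathbb{R}$, and let $s_{\rm r}:[0,\infty)\to\mathbb{R}$ be smooth and such that, for some $d\in[1,2]$, $M>0$, $R>0$, $|s_{\rm r}^{(m+1)}(t)|\le M\,(m!)^d/R^m$ for all integers $m\ge0$ and all $t\ge0$. Let $a_n$, $F$, $G$ be as defined in the context. Then the radius of convergence of the infinite series $$T^{\rm r}(x,t)=T_{\rm m}+\sum_{n=0}^\infty\frac{a_n(t)}{n!}(x-s_{\rm r}(t))^n$$ (a power series in $x-s_{\rm r}(t)$) is given by $R/F$. Namely, if $$R\ge F\sup_{t\ge0}|s_{\rm r}(t)|,$$ then the series converges, and it holds, for all $t\ge0$ and $0<x<s_{\rm r}(t)$, $$|T^{\rm r}(x,t)-T_{\rm m}|\le\frac{MGR}{F\,(R-F(s_{\rm r}(t)-x))},\qquad |T^{\rm r}_x(x,t)|\le\frac{MGR}{(R-F(s_{\rm r}(t)-x))^2}.$$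
   Context: The coefficients are $a_0(t)=0$, $a_1(t)=-\frac1\beta(\varepsilon\ddot s_{\rm r}(t)+\dot s_{\rm r}(t))$, and $a_n(t)=\frac1\alpha(\dot a_{n-2}(t)-\dot s_{\rm r}(t)a_{n-1}(t))$ for $n\ge2$. The constants are $G=\frac1\beta(\varepsilon+R)$ and $F=\dfrac{RM+\sqrt{R^2M^2+16\alpha R}}{4\alpha}$. Superscript $(m)$ denotes the $m$-th time derivative. $T^{\rm r}_x$ is the partial derivative in $x$.
   Formalization: "The radius of convergence is given by R/F" is proved as "is at least R/F" for every t ≥ 0; equality is false, e.g. for constant s_r all a_n vanish and the radius is infinite. *)

theory Defs
  imports "HOL-Analysis.Analysis"
begin

text \<open>
  Functions of time live on the half-line; they are represented by total functions whose values
  at negative times are irrelevant.  Time derivatives are therefore taken within \<open>{0..}\<close>,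
  hence one-sided at \<open>t = 0\<close>, and are only meaningful for \<open>t \<ge> 0\<close>.
\<close>

definition time_deriv :: "(real \<Rightarrow> real) \<Rightarrow> real \<Rightarrow> real" where
  "time_deriv f t = vector_derivative f (at t within {0..})"

definition smooth_halfline :: "(real \<Rightarrow> real) \<Rightarrow> bool" where
  "smooth_halfline f \<longleftrightarrow>
     (\<forall>m. \<forall>t\<ge>0. (time_deriv ^^ m) f differentiable (at t within {0..}))"

fun series_coeff ::
  "real \<Rightarrow> real \<Rightarrow> real \<Rightarrow> (real \<Rightarrow> real) \<Rightarrow> nat \<Rightarrow> real \<Rightarrow> real" where
  "series_coeff \<alpha> \<beta> \<epsilon> s 0 = (\<lambda>t. 0)"
| "series_coeff \<alpha> \<beta> \<epsilon> s (Suc 0) =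
     (\<lambda>t. - (1 / \<beta>) * (\<epsilon> * (time_deriv ^^ 2) s t + time_deriv s t))"
| "series_coeff \<alpha> \<beta> \<epsilon> s (Suc (Suc n)) =
     (\<lambda>t. 1 / \<alpha> * (time_deriv (series_coeff \<alpha> \<beta> \<epsilon> s n) t
                       - time_deriv s t * series_coeff \<alpha> \<beta> \<epsilon> s (Suc n) t))"

definition T_ref ::
  "real \<Rightarrow> real \<Rightarrow> real \<Rightarrow> real \<Rightarrow> (real \<Rightarrow> real) \<Rightarrow> real \<Rightarrow> real \<Rightarrow> real" where
  "T_ref \<alpha> \<beta> \<epsilon> Tm s x t =
     Tm + (\<Sum>n. series_coeff \<alpha> \<beta> \<epsilon> s n t / fact n * (x - s t) ^ n)"

definition G_const :: "real \<Rightarrow> real \<Rightarrow> real \<Rightarrow> real" where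
  "G_const \<beta> \<epsilon> R = 1 / \<beta> * (\<epsilon> + R)"

definition F_const :: "real \<Rightarrow> real \<Rightarrow> real \<Rightarrow> real" where
  "F_const \<alpha> M R = (R * M + sqrt (R\<^sup>2 * M\<^sup>2 + 16 * \<alpha> * R)) / (4 * \<alpha>)"

end

theory Submission imports Defs begin

text \<open>
  The claim reduces to the bound \<open>\<bar>a\<^sub>n(t)\<bar> \<le> (MG/F) (F/R)\<^sup>n n!\<close>: the Taylor coefficients are then dominated by
  those of a geometric series with ratio \<open>F/R\<close>, whose sum and derivative are exactly the two
  right-hand sides (\<open>suminf_geometric_majorant\<close>, \<open>deriv_geometric_majorant\<close>).

  Since \<open>a\<^sub>n\<close> is built from the time derivative of \<open>a\<^sub>n\<^sub>-\<^sub>2\<close>, this bound can only be propagated through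
  the recursion together with bounds on all time derivatives (\<open>series_coeff_gevrey_bound\<close>). A suitable
  majorant for the \<open>m\<close>-th derivative of \<open>a\<^sub>n\<close> is the Gevrey expression
  \<open>(MG/F) F\<^sup>n R\<^sup>-\<^sup>(\<^sup>n\<^sup>+\<^sup>m\<^sup>) (n+m)!\<^sup>d / n!\<^sup>d\<^sup>-\<^sup>1\<close>. At \<open>n = 1\<close> it is what the hypothesis on \<open>s\<close> gives for \<open>a\<^sub>1\<close>,
  which explains the constant \<open>G\<close>, and at \<open>m = 0\<close> the factorials reduce to \<open>n!\<close>. The two terms of
  the recursion contribute as follows.

  \<^item> The derivative of \<open>a\<^sub>n\<^sub>-\<^sub>2\<close> contributes at most \<open>R/F\<^sup>2\<close> times the majorant: trading two units of \<open>n\<close>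
    for one of \<open>m\<close> multiplies the factorials by \<open>(n(n-1))\<^sup>d\<^sup>-\<^sup>1/(n+m)\<^sup>d\<close>, which is at most \<open>1\<close> because
    \<open>d \<le> 2\<close> (\<open>gevrey_Suc_right_le\<close>).

  \<^item> The product of \<open>s'\<close> and \<open>a\<^sub>n\<^sub>-\<^sub>1\<close>, expanded by the Leibniz rule, contributes at most \<open>RM/F\<close> times
    \<open>1/n\<close> times the majorant: for \<open>d = 1\<close> the sum of the Leibniz terms is a hockey-stick sum, and
    for \<open>d > 1\<close> no term grows relative to the majorant (\<open>gevrey_Leibniz_le\<close>).

  As \<open>n \<ge> 2\<close>, the induction closes if \<open>R/F\<^sup>2 + RM/(2F) \<le> \<alpha>\<close>, and \<open>F\<close> is the positive number for which
  equality holds (\<open>F_const_balance\<close>).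
\<close>

section \<open>Iterated derivatives on the half-line\<close>

lemma time_deriv_eqI:
  assumes "(f has_real_derivative D) (at t within {0..})" "t \<ge> 0"
  shows "time_deriv f t = D"
proof -
  have "at t within {0..} \<noteq> bot"
  proof (cases "t = 0")
    case True
    then show ?thesis by (simp add: at_within_Ici_at_right)
  next
    case False
    with \<open>t \<ge> 0\<close> have "at t within {0..} = at t"
      by (intro at_within_interior) auto
    then show ?thesis by simp
  qed
  then show ?thesis
    using assms(1) unfolding time_deriv_def has_real_derivative_iff_has_vector_derivative
    by (rule vector_derivative_within)
qed

lemma smooth_halfline_has_derivative:
  assumes "smooth_halfline f" "t \<ge> 0"
  shows "((time_deriv ^^ m) f has_real_derivative (time_deriv ^^ Suc m) f t) (at t within {0..})"
  using assms unfolding smooth_halfline_def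
  by (simp add: has_real_derivative_iff_has_vector_derivative time_deriv_def
      vector_derivative_works[symmetric])

text \<open>
  Exhibiting a tower of successive derivatives proves smoothness and computes all
  iterated time derivatives at once. For linear combinations and products, the tower is the
  expected differentiation formula.
\<close>

lemma derivative_tower:
  assumes "\<And>m t. t \<ge> 0 \<Longrightarrow> (h m has_real_derivative h (Suc m) t) (at t within {0..})"
    and "\<And>t. t \<ge> 0 \<Longrightarrow> f t = h 0 t"
  shows smooth_halfline_tower: "smooth_halfline f"
    and funpow_time_deriv_tower: "t \<ge> 0 \<Longrightarrow> (time_deriv ^^ m) f t = h m t"
proof -
  have *: "\<forall>t\<ge>0. (time_deriv ^^ m) f t = h m t \<and>
    ((time_deriv ^^ m) f has_real_derivative h (Suc m) t) (at t within {0..})" for m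
  proof (induction m)
    case 0
    have "(f has_real_derivative h (Suc 0) t) (at t within {0..})" if "t \<ge> 0" for t
      using assms(1)[OF that, of 0] assms(2) that
      by (rule_tac has_field_derivative_transform_within[where d = 1]) auto
    then show ?case by (simp add: assms(2))
  next
    case (Suc m)
    have eq: "(time_deriv ^^ Suc m) f t = h (Suc m) t" if "t \<ge> 0" for t
      using Suc.IH that by (simp add: time_deriv_eqI)
    moreover have "((time_deriv ^^ Suc m) f has_real_derivative h (Suc (Suc m)) t)
        (at t within {0..})" if "t \<ge> 0" for t
      using assms(1)[OF that, of "Suc m"] eq that
      by (rule_tac has_field_derivative_transform_within[where d = 1]) auto
    ultimately show ?case by blast
  qed
  show "smooth_halfline f"
    unfolding smooth_halfline_def
    using * real_differentiable_def by blast
  show "(time_deriv ^^ m) f t = h m t" if "t \<ge> 0"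
    using * that by blast
qed

lemma funpow_time_deriv_time_deriv:
  "(time_deriv ^^ m) (time_deriv f) = (time_deriv ^^ Suc m) f"
  by (simp only: funpow_Suc_right o_apply)

lemma smooth_halfline_time_deriv:
  assumes "smooth_halfline f"
  shows "smooth_halfline (time_deriv f)"
  using assms unfolding smooth_halfline_def funpow_time_deriv_time_deriv by blast

lemma
  assumes f: "smooth_halfline f" and g: "smooth_halfline g"
  shows smooth_halfline_lincomb: "smooth_halfline (\<lambda>t. b * f t + c * g t)"
    and funpow_time_deriv_lincomb: "t \<ge> 0 \<Longrightarrow>
      (time_deriv ^^ m) (\<lambda>t. b * f t + c * g t) t =
        b * (time_deriv ^^ m) f t + c * (time_deriv ^^ m) g t"
proof -
  let ?h = "\<lambda>m t. b * (time_deriv ^^ m) f t + c * (time_deriv ^^ m) g t"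
  have der: "(?h m has_real_derivative ?h (Suc m) t) (at t within {0..})" if "t \<ge> 0" for m t
    using that by (intro DERIV_add DERIV_cmult smooth_halfline_has_derivative f g)
  show "smooth_halfline (\<lambda>t. b * f t + c * g t)"
    by (rule smooth_halfline_tower[of ?h, OF der]) auto
  show "(time_deriv ^^ m) (\<lambda>t. b * f t + c * g t) t = ?h m t" if "t \<ge> 0"
    by (rule funpow_time_deriv_tower[of ?h, OF der]) (use that in auto)
qed

text \<open>
  Pascal's rule turns the term-by-term derivative of a Leibniz sum into the next Leibniz sum.
\<close>

lemma Leibniz_sum_Suc:
  fixes u v :: "nat \<Rightarrow> real"
  shows "(\<Sum>j\<le>m. real (m choose j) * (u (Suc j) * v (m - j) + u j * v (Suc (m - j)))) =
    (\<Sum>j\<le>Suc m. real (Suc m choose j) * (u j * v (Suc m - j)))"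
proof -
  let ?w = "\<lambda>j. u j * v (Suc m - j)"
  have "(\<Sum>j\<le>Suc m. real (Suc m choose j) * ?w j) =
      ?w 0 + (\<Sum>j\<le>m. real (Suc m choose Suc j) * ?w (Suc j))"
    by (subst sum.atMost_Suc_shift) simp
  also have "\<dots> = (?w 0 + (\<Sum>j\<le>m. real (m choose Suc j) * ?w (Suc j)))
      + (\<Sum>j\<le>m. real (m choose j) * ?w (Suc j))"
    by (simp add: sum.distrib algebra_simps)
  also have "?w 0 + (\<Sum>j\<le>m. real (m choose Suc j) * ?w (Suc j)) =
      (\<Sum>j\<le>Suc m. real (m choose j) * ?w j)"
    by (subst sum.atMost_Suc_shift) simp
  also have "\<dots> = (\<Sum>j\<le>m. real (m choose j) * ?w j)"
    by simp
  also have "\<dots> = (\<Sum>j\<le>m. real (m choose j) * (u j * v (Suc (m - j))))"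
    by (intro sum.cong) (auto simp: Suc_diff_le)
  finally show ?thesis
    by (simp add: sum.distrib distrib_left add.commute)
qed

lemma
  assumes f: "smooth_halfline f" and g: "smooth_halfline g"
  shows smooth_halfline_mult: "smooth_halfline (\<lambda>t. f t * g t)"
    and funpow_time_deriv_mult: "t \<ge> 0 \<Longrightarrow>
      (time_deriv ^^ m) (\<lambda>t. f t * g t) t =
        (\<Sum>j\<le>m. real (m choose j) * ((time_deriv ^^ j) f t * (time_deriv ^^ (m - j)) g t))"
proof -
  let ?h = "\<lambda>m t. \<Sum>j\<le>m. real (m choose j) * ((time_deriv ^^ j) f t * (time_deriv ^^ (m - j)) g t)"
  have der: "(?h m has_real_derivative ?h (Suc m) t) (at t within {0..})" if "t \<ge> 0" for m t
  proof -
    have "(?h m has_real_derivative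
        (\<Sum>j\<le>m. real (m choose j) *
          ((time_deriv ^^ Suc j) f t * (time_deriv ^^ (m - j)) g t
            + (time_deriv ^^ j) f t * (time_deriv ^^ Suc (m - j)) g t))) (at t within {0..})"
    proof (intro DERIV_sum DERIV_cmult)
      fix j
      show "((\<lambda>t. (time_deriv ^^ j) f t * (time_deriv ^^ (m - j)) g t) has_real_derivative
          (time_deriv ^^ Suc j) f t * (time_deriv ^^ (m - j)) g t
            + (time_deriv ^^ j) f t * (time_deriv ^^ Suc (m - j)) g t) (at t within {0..})"
        using DERIV_mult[OF smooth_halfline_has_derivative[OF f that, of j]
            smooth_halfline_has_derivative[OF g that, of "m - j"]]
        by (simp only: add.commute mult.commute)
    qed
    then show ?thesis
      by (subst (asm) Leibniz_sum_Suc[of m "\<lambda>j. (time_deriv ^^ j) f t" "\<lambda>j. (time_deriv ^^ j) g t"])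
  qed
  show "smooth_halfline (\<lambda>t. f t * g t)"
    by (rule smooth_halfline_tower[of ?h, OF der]) auto
  show "(time_deriv ^^ m) (\<lambda>t. f t * g t) t = ?h m t" if "t \<ge> 0"
    by (rule funpow_time_deriv_tower[of ?h, OF der]) (use that in auto)
qed

section \<open>Factorial estimates\<close>

text \<open>
  This is \<open>(n+m)!\<^sup>d / n!\<^sup>d\<^sup>-\<^sup>1\<close> for \<open>d = p + 1\<close>. Splitting off one factor \<open>(n+m)!\<close> leaves
  a quotient raised to a power \<open>p \<in> [0, 1]\<close>, so that inequalities between quotients can be carried
  over by monotonicity.
\<close>

definition gevrey :: "real \<Rightarrow> nat \<Rightarrow> nat \<Rightarrow> real" where
  "gevrey p n m = fact (n + m) * (fact (n + m) / fact n) powr p"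

lemma gevrey_0_right: "gevrey p n 0 = fact n"
  by (simp add: gevrey_def)

lemma gevrey_nonneg: "gevrey p n m \<ge> 0"
  by (simp add: gevrey_def)

lemma gevrey_1_left: "gevrey p 1 m = fact (Suc m) powr (p + 1)"
  by (simp add: gevrey_def powr_add del: fact_Suc)

text \<open>
  With \<open>N = n + m + 2\<close>, the quotient \<open>(N-1)!/n!\<close> exceeds \<open>N!/(n+2)!\<close> by the factor
  \<open>(n+1)(n+2)/N \<le> N\<close>; its power is at most \<open>N\<^sup>p \<le> N\<close>, and a factor \<open>N\<close> is gained from
  \<open>(N-1)!\<close> to \<open>N!\<close>.
\<close>

lemma gevrey_Suc_right_le:
  assumes "0 \<le> p" "p \<le> 1"
  shows "gevrey p n (Suc m) \<le> gevrey p (Suc (Suc n)) m"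
proof -
  define N where "N = real (n + m + 2)"
  have N: "N \<ge> 1" by (simp add: N_def)
  have fN: "fact (Suc (Suc n) + m) = N * fact (n + Suc m)"
    by (simp add: N_def algebra_simps)
  have "fact (n + Suc m) / fact n \<le> N * (fact (Suc (Suc n) + m) / fact (Suc (Suc n)) :: real)"
  proof -
    have "(real n + 1) * (real n + 2) \<le> N * N"
      by (intro mult_mono) (auto simp: N_def)
    then have "fact (n + Suc m) * ((real n + 1) * (real n + 2)) / fact (Suc (Suc n))
        \<le> fact (n + Suc m) * (N * N) / fact (Suc (Suc n))"
      by (intro mult_left_mono divide_right_mono) auto
    moreover have "fact (Suc (Suc n)) = (real n + 1) * (real n + 2) * fact n"
      by (simp add: algebra_simps)
    ultimately show ?thesis
      unfolding fN by (simp del: fact_Suc add: mult_ac)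
  qed
  then have "(fact (n + Suc m) / fact n) powr p
      \<le> (N * (fact (Suc (Suc n) + m) / fact (Suc (Suc n)))) powr p"
    using assms by (intro powr_mono2) auto
  also have "\<dots> = N powr p * (fact (Suc (Suc n) + m) / fact (Suc (Suc n))) powr p"
    by (rule powr_mult)
  also have "\<dots> \<le> N * (fact (Suc (Suc n) + m) / fact (Suc (Suc n))) powr p"
    using N assms powr_mono[of p 1 N] by (intro mult_right_mono) auto
  finally have "gevrey p n (Suc m)
      \<le> fact (n + Suc m) * (N * (fact (Suc (Suc n) + m) / fact (Suc (Suc n))) powr p)"
    unfolding gevrey_def by (intro mult_left_mono) auto
  also have "\<dots> = gevrey p (Suc (Suc n)) m"
    unfolding gevrey_def fN by simp
  finally show ?thesis .
qed

text \<open>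
  This is the hockey-stick identity \<open>\<Sum>\<^sub>i\<^sub>\<le>\<^sub>m (n+i choose i) = (n+m+1 choose m)\<close> multiplied by \<open>m! n!\<close>.
\<close>

lemma sum_choose_fact_fact:
  "(\<Sum>j\<le>m. real (m choose j) * (fact j * fact (n + (m - j)))) = fact (Suc n + m) / (real n + 1)"
proof -
  have "(\<Sum>j\<le>m. real (m choose j) * (fact j * fact (n + (m - j)))) =
      (\<Sum>j\<le>m. fact m * fact n * real ((n + (m - j)) choose (m - j)))"
  proof (intro sum.cong refl)
    fix j assume "j \<in> {..m}"
    then show "real (m choose j) * (fact j * fact (n + (m - j))) =
        fact m * fact n * real ((n + (m - j)) choose (m - j))"
      by (simp add: binomial_fact)
  qed
  also have "\<dots> = fact m * fact n * real (\<Sum>j\<le>m. (n + (m - j)) choose (m - j))"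
    by (simp add: sum_distrib_left)
  also have "(\<Sum>j\<le>m. (n + (m - j)) choose (m - j)) = (\<Sum>j\<le>m. (n + j) choose j)"
    using sum.nat_diff_reindex[of "\<lambda>j. (n + j) choose j" "Suc m"]
    by (simp add: lessThan_Suc_atMost)
  also have "\<dots> = (Suc n + m) choose m"
    by (simp only: sum_choose_lower add_Suc)
  also have "fact m * fact n * real ((Suc n + m) choose m) = fact (Suc n + m) / (real n + 1)"
  proof -
    have "real ((Suc n + m) choose m) = fact (Suc n + m) / (fact m * fact (Suc n))"
      by (subst binomial_fact) auto
    also have "fact (Suc n) = (real n + 1) * fact n"
      by simp
    finally show ?thesis
      by (simp del: fact_Suc)
  qed
  finally show ?thesis .
qed

text \<open>
  Each Leibniz term splits into its value for \<open>p = 0\<close>, which \<open>sum_choose_fact_fact\<close> sums up, and a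
  quotient of factorials bounded uniformly in \<open>j\<close> by the one occurring in the target.
\<close>

lemma gevrey_Leibniz_le:
  assumes "0 \<le> p"
  shows "(\<Sum>j\<le>m. real (m choose j) * (fact j powr (p + 1) * gevrey p n (m - j)))
    \<le> gevrey p (Suc n) m / (real n + 1)"
proof -
  let ?Q = "(fact (Suc n + m) / fact (Suc n)) powr p :: real"
  have "real (m choose j) * (fact j powr (p + 1) * gevrey p n (m - j))
      \<le> real (m choose j) * (fact j * fact (n + (m - j))) * ?Q" if "j \<le> m" for j
  proof -
    have "fact j * fact (n + (m - j)) \<le> (fact (n + m) :: nat)"
      using that fact_fact_dvd_fact[of j "n + (m - j)", where 'a = nat]
      by (intro dvd_imp_le) (auto simp: algebra_simps)
    then have le: "fact j * fact (n + (m - j)) \<le> (fact (n + m) :: real)"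
      by (metis of_nat_fact of_nat_le_iff of_nat_mult)
    have "fact j * (fact (n + (m - j)) / fact n) \<le> (fact (n + m) / fact n :: real)"
      using divide_right_mono[OF le, of "fact n"] by simp
    also have "\<dots> = (real n + 1) * fact (n + m) / ((real n + 1) * fact n)"
      by simp
    also have "(real n + 1) * fact n = fact (Suc n)"
      by simp
    also have "(real n + 1) * fact (n + m) / fact (Suc n) \<le> fact (Suc n + m) / fact (Suc n)"
      by (intro divide_right_mono) (auto simp: algebra_simps)
    finally have "(fact j * (fact (n + (m - j)) / fact n)) powr p \<le> ?Q"
      using assms by (intro powr_mono2) auto
    then have "fact j powr p * (fact (n + (m - j)) / fact n) powr p \<le> ?Q"
      by (subst powr_mult[symmetric]) auto
    then have "real (m choose j) * (fact j * fact (n + (m - j)))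
        * (fact j powr p * (fact (n + (m - j)) / fact n) powr p)
        \<le> real (m choose j) * (fact j * fact (n + (m - j))) * ?Q"
      by (intro mult_left_mono) auto
    then show ?thesis
      by (simp add: gevrey_def powr_add mult_ac)
  qed
  then have "(\<Sum>j\<le>m. real (m choose j) * (fact j powr (p + 1) * gevrey p n (m - j)))
      \<le> (\<Sum>j\<le>m. real (m choose j) * (fact j * fact (n + (m - j))) * ?Q)"
    by (intro sum_mono) auto
  also have "\<dots> = gevrey p (Suc n) m / (real n + 1)"
    unfolding sum_distrib_right[symmetric] sum_choose_fact_fact gevrey_def by simp
  finally show ?thesis .
qed

section \<open>Gevrey bounds for the coefficients\<close>

lemma F_const_pos:
  assumes "\<alpha> > 0" "M > 0" "R > 0"
  shows "F_const \<alpha> M R > 0"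
  using assms unfolding F_const_def by (intro divide_pos_pos add_pos_nonneg) auto

lemma F_const_quadratic:
  assumes "\<alpha> > 0" "R > 0"
  shows "2 * \<alpha> * (F_const \<alpha> M R)\<^sup>2 = R * M * F_const \<alpha> M R + 2 * R"
proof -
  define r where "r = sqrt (R\<^sup>2 * M\<^sup>2 + 16 * \<alpha> * R)"
  have r2: "r\<^sup>2 = R\<^sup>2 * M\<^sup>2 + 16 * \<alpha> * R"
    unfolding r_def using assms by (intro real_sqrt_pow2) auto
  have F: "F_const \<alpha> M R = (R * M + r) / (4 * \<alpha>)"
    by (simp add: F_const_def r_def)
  have "8 * \<alpha> * (2 * \<alpha> * (F_const \<alpha> M R)\<^sup>2) = (R * M + r)\<^sup>2"
    unfolding F using assms by (simp add: field_simps power2_eq_square)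
  also have "\<dots> = 2 * R * M * (R * M + r) + 16 * \<alpha> * R"
    using r2 by (simp add: power2_eq_square algebra_simps)
  also have "\<dots> = 8 * \<alpha> * (R * M * F_const \<alpha> M R + 2 * R)"
    unfolding F using assms by (simp add: field_simps)
  finally show ?thesis using assms by simp
qed

text \<open>
  This identity is the purpose of the formula for \<open>F\<close>: the contributions of the two terms of the
  recursion add up to exactly the factor \<open>\<alpha>\<close> by which the recursion divides.
\<close>

lemma F_const_balance:
  assumes "\<alpha> > 0" "M > 0" "R > 0"
  shows "R / (F_const \<alpha> M R)\<^sup>2 + R * M / (2 * F_const \<alpha> M R) = \<alpha>"
  using F_const_quadratic[OF assms(1,3), of M] F_const_pos[OF assms]
  by (simp add: field_simps power2_eq_square)

lemma smooth_series_coeff: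
  assumes s: "smooth_halfline s"
  shows "smooth_halfline (series_coeff \<alpha> \<beta> \<epsilon> s n)"
proof (induction n rule: induct_nat_012)
  case 0
  show ?case
    by (rule smooth_halfline_tower[of "\<lambda>_ _. 0"]) auto
next
  case 1
  have "smooth_halfline (\<lambda>t. - (\<epsilon> / \<beta>) * time_deriv (time_deriv s) t + - (1 / \<beta>) * time_deriv s t)"
    by (intro smooth_halfline_lincomb smooth_halfline_time_deriv s)
  then show ?case
    by (simp add: numeral_2_eq_2 algebra_simps)
next
  case (ge2 n)
  have "smooth_halfline (\<lambda>t. 1 / \<alpha> * time_deriv (series_coeff \<alpha> \<beta> \<epsilon> s n) t
      + - (1 / \<alpha>) * (time_deriv s t * series_coeff \<alpha> \<beta> \<epsilon> s (Suc n) t))"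
    by (intro smooth_halfline_lincomb smooth_halfline_mult smooth_halfline_time_deriv s ge2)
  then show ?case
    by (simp add: algebra_simps)
qed

lemma funpow_time_deriv_series_coeff_1:
  assumes "smooth_halfline s" "t \<ge> 0"
  shows "(time_deriv ^^ m) (series_coeff \<alpha> \<beta> \<epsilon> s (Suc 0)) t =
    - (1 / \<beta>) * (\<epsilon> * (time_deriv ^^ Suc (Suc m)) s t + (time_deriv ^^ Suc m) s t)"
proof -
  have "series_coeff \<alpha> \<beta> \<epsilon> s (Suc 0) =
      (\<lambda>t. - (\<epsilon> / \<beta>) * time_deriv (time_deriv s) t + - (1 / \<beta>) * time_deriv s t)"
    by (simp add: numeral_2_eq_2 algebra_simps)
  then show ?thesis
    using assms
    by (simp only: funpow_time_deriv_lincomb smooth_halfline_time_deriv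
        funpow_time_deriv_time_deriv) (simp add: algebra_simps)
qed

lemma funpow_time_deriv_series_coeff_Suc_Suc:
  assumes "smooth_halfline s" "t \<ge> 0"
  shows "(time_deriv ^^ m) (series_coeff \<alpha> \<beta> \<epsilon> s (Suc (Suc n))) t =
    1 / \<alpha> * ((time_deriv ^^ Suc m) (series_coeff \<alpha> \<beta> \<epsilon> s n) t -
      (\<Sum>j\<le>m. real (m choose j) * ((time_deriv ^^ Suc j) s t *
        (time_deriv ^^ (m - j)) (series_coeff \<alpha> \<beta> \<epsilon> s (Suc n)) t)))"
proof -
  have "series_coeff \<alpha> \<beta> \<epsilon> s (Suc (Suc n)) =
      (\<lambda>t. 1 / \<alpha> * time_deriv (series_coeff \<alpha> \<beta> \<epsilon> s n) t
        + - (1 / \<alpha>) * (time_deriv s t * series_coeff \<alpha> \<beta> \<epsilon> s (Suc n) t))"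
    by (simp add: algebra_simps)
  then show ?thesis
    using assms
    by (simp only: funpow_time_deriv_lincomb funpow_time_deriv_mult smooth_halfline_time_deriv
        smooth_halfline_mult smooth_series_coeff funpow_time_deriv_time_deriv)
      (simp add: algebra_simps)
qed

text \<open>
  The induction needs all \<open>m\<close> simultaneously, because the recursion uses one more derivative of
  the coefficient two steps below. The cases \<open>n = 0, 1\<close> start it; the recursion begins at \<open>n = 2\<close>,
  which is why the factor \<open>1/n\<close> of the Leibniz sum may be replaced by \<open>1/2\<close>, as the identity for
  \<open>F\<close> requires.
\<close>

lemma series_coeff_gevrey_bound:
  assumes pos: "\<alpha> > 0" "\<beta> > 0" "\<epsilon> > 0" "M > 0" "R > 0"
    and p: "0 \<le> p" "p \<le> 1"
    and s: "smooth_halfline s"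
    and bound: "\<And>m t. t \<ge> 0 \<Longrightarrow> \<bar>(time_deriv ^^ Suc m) s t\<bar> \<le> M * fact m powr (p + 1) / R ^ m"
    and t: "t \<ge> 0"
  defines "F \<equiv> F_const \<alpha> M R" and "G \<equiv> G_const \<beta> \<epsilon> R"
  shows "\<bar>(time_deriv ^^ m) (series_coeff \<alpha> \<beta> \<epsilon> s n) t\<bar>
    \<le> M * G / F * F ^ n / R ^ (n + m) * gevrey p n m"
proof (induction n arbitrary: m rule: induct_nat_012)
  case 0
  have F: "F > 0" and G: "G > 0"
    using F_const_pos pos by (auto simp: F_def G_def G_const_def)
  have "(time_deriv ^^ m) (\<lambda>t. 0) t = 0"
    using funpow_time_deriv_tower[of "\<lambda>_ _. 0" "\<lambda>t. 0"] t by simp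
  then show ?case
    using F G pos by (simp add: gevrey_nonneg)
next
  case 1
  have F: "F > 0" using F_const_pos pos by (simp add: F_def)
  let ?X = "fact (Suc m) powr (p + 1) :: real"
  have "\<bar>(time_deriv ^^ m) (series_coeff \<alpha> \<beta> \<epsilon> s (Suc 0)) t\<bar> =
      1 / \<beta> * \<bar>\<epsilon> * (time_deriv ^^ Suc (Suc m)) s t + (time_deriv ^^ Suc m) s t\<bar>"
    using pos by (simp only: funpow_time_deriv_series_coeff_1[OF s t] abs_mult) simp
  also have "\<dots> \<le> 1 / \<beta> * (\<epsilon> * (M * ?X / R ^ Suc m) + M * ?X / R ^ m)"
  proof (intro mult_left_mono order_trans[OF abs_triangle_ineq] add_mono)
    show "\<bar>\<epsilon> * (time_deriv ^^ Suc (Suc m)) s t\<bar> \<le> \<epsilon> * (M * ?X / R ^ Suc m)"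
      using mult_left_mono[OF bound[OF t, of "Suc m"], of \<epsilon>] pos
        by (simp add: abs_mult del: fact_Suc funpow.simps)
    \<comment> \<open>Enlarging \<open>m!\<close> to \<open>(m+1)!\<close> lets both terms of \<open>a\<^sub>1\<close> combine to \<open>\<epsilon> + R\<close>, that is, to \<open>\<beta> G\<close>.\<close>
    have "fact m powr (p + 1) \<le> ?X"
      using p by (intro powr_mono2 fact_mono) auto
    then have "M * fact m powr (p + 1) / R ^ m \<le> M * ?X / R ^ m"
      using pos by (intro divide_right_mono mult_left_mono) auto
    then show "\<bar>(time_deriv ^^ Suc m) s t\<bar> \<le> M * ?X / R ^ m"
      using bound[OF t, of m] by simp
  qed (use pos in auto)
  also have "\<dots> = M * G / R ^ Suc m * ?X"
    using pos by (simp add: G_def G_const_def field_simps)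
  also have "\<dots> = M * G / F * F ^ 1 / R ^ (1 + m) * gevrey p 1 m"
    using F by (simp only: gevrey_1_left) simp
  finally show ?case by simp
next
  case (ge2 n)
  have F: "F > 0" and G: "G > 0"
    using F_const_pos pos by (auto simp: F_def G_def G_const_def)
  define K where "K = M * G / F"
  have K: "K > 0" using pos F G by (simp add: K_def)
  let ?a = "\<lambda>n. series_coeff \<alpha> \<beta> \<epsilon> s n"
  define B where "B = K * F ^ Suc (Suc n) / R ^ (Suc (Suc n) + m) * gevrey p (Suc (Suc n)) m"
  have B: "B \<ge> 0"
    using K F pos by (simp add: B_def gevrey_nonneg)
  have "\<bar>(time_deriv ^^ Suc m) (?a n) t\<bar> \<le> K * F ^ n / R ^ (n + Suc m) * gevrey p n (Suc m)"
    using ge2(1)[of "Suc m"] by (simp only: K_def)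
  also have "\<dots> \<le> K * F ^ n / R ^ (n + Suc m) * gevrey p (Suc (Suc n)) m"
    using K F pos p by (intro mult_left_mono gevrey_Suc_right_le) auto
  also have "\<dots> = R / F\<^sup>2 * B"
    using F pos by (simp add: B_def field_simps power2_eq_square)
  finally have first: "\<bar>(time_deriv ^^ Suc m) (?a n) t\<bar> \<le> R / F\<^sup>2 * B" .

  let ?S = "\<Sum>j\<le>m. real (m choose j) *
    ((time_deriv ^^ Suc j) s t * (time_deriv ^^ (m - j)) (?a (Suc n)) t)"
  have "\<bar>?S\<bar> \<le> (\<Sum>j\<le>m. real (m choose j) *
    (\<bar>(time_deriv ^^ Suc j) s t\<bar> * \<bar>(time_deriv ^^ (m - j)) (?a (Suc n)) t\<bar>))"
    by (rule order_trans[OF sum_abs]) (simp only: abs_mult abs_of_nat order_refl)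
  also have "\<dots> \<le> (\<Sum>j\<le>m. real (m choose j) *
    (M * fact j powr (p + 1) / R ^ j *
      (K * F ^ Suc n / R ^ (Suc n + (m - j)) * gevrey p (Suc n) (m - j))))"
    using ge2(2) bound[OF t] pos
    by (intro sum_mono mult_left_mono mult_mono) (auto simp only: K_def, auto)
  also have "\<dots> = (\<Sum>j\<le>m. M * K * F ^ Suc n / R ^ (Suc n + m) *
    (real (m choose j) * (fact j powr (p + 1) * gevrey p (Suc n) (m - j))))"
  proof (intro sum.cong refl)
    fix j assume "j \<in> {..m}"
    then have "R ^ (Suc n + m) = R ^ j * R ^ (Suc n + (m - j))"
      by (simp flip: power_add add: algebra_simps)
    then show "real (m choose j) * (M * fact j powr (p + 1) / R ^ j *
          (K * F ^ Suc n / R ^ (Suc n + (m - j)) * gevrey p (Suc n) (m - j))) =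
        M * K * F ^ Suc n / R ^ (Suc n + m) *
          (real (m choose j) * (fact j powr (p + 1) * gevrey p (Suc n) (m - j)))"
      by (simp del: power_Suc add_Suc)
  qed
  also have "\<dots> = M * K * F ^ Suc n / R ^ (Suc n + m) *
    (\<Sum>j\<le>m. real (m choose j) * (fact j powr (p + 1) * gevrey p (Suc n) (m - j)))"
    by (simp only: sum_distrib_left)
  also have "\<dots> \<le> M * K * F ^ Suc n / R ^ (Suc n + m) * (gevrey p (Suc (Suc n)) m / (real (Suc n) + 1))"
    using pos K F p by (intro mult_left_mono gevrey_Leibniz_le) auto
  also have "\<dots> \<le> M * K * F ^ Suc n / R ^ (Suc n + m) * (gevrey p (Suc (Suc n)) m / 2)"
    using pos K F by (intro mult_left_mono divide_left_mono) (auto simp: gevrey_nonneg)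
  also have "\<dots> = R * M / (2 * F) * B"
    using F pos by (simp add: B_def field_simps)
  finally have second: "\<bar>?S\<bar> \<le> R * M / (2 * F) * B" .

  have "\<bar>(time_deriv ^^ m) (?a (Suc (Suc n))) t\<bar> = 1 / \<alpha> * \<bar>(time_deriv ^^ Suc m) (?a n) t - ?S\<bar>"
    using pos by (simp only: funpow_time_deriv_series_coeff_Suc_Suc[OF s t] abs_mult) simp
  also have "\<dots> \<le> 1 / \<alpha> * (R / F\<^sup>2 * B + R * M / (2 * F) * B)"
    using pos first second by (intro mult_left_mono order_trans[OF abs_triangle_ineq4] add_mono) auto
  also have "\<dots> = 1 / \<alpha> * ((R / F\<^sup>2 + R * M / (2 * F)) * B)"
    by (simp only: distrib_right)
  also have "\<dots> = B"
    using F_const_balance[OF pos(1,4,5)] pos by (simp add: F_def)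
  finally show ?case
    unfolding B_def K_def .
qed

section \<open>Power series with geometrically bounded coefficients\<close>

lemma geometric_majorant:
  fixes c :: "nat \<Rightarrow> real"
  assumes c: "\<And>n. \<bar>c n\<bar> \<le> K * q ^ n" and q: "q > 0" and x: "q * \<bar>x\<bar> < 1"
  shows summable_geometric_majorant: "summable (\<lambda>n. c n * x ^ n)"
    and suminf_geometric_majorant: "\<bar>\<Sum>n. c n * x ^ n\<bar> \<le> K / (1 - q * \<bar>x\<bar>)"
proof -
  have "(\<lambda>n. K * (q * \<bar>x\<bar>) ^ n) sums (K * (1 / (1 - q * \<bar>x\<bar>)))"
    using q x by (intro sums_mult geometric_sums) (auto simp: abs_mult)
  moreover have le: "norm (c n * x ^ n) \<le> K * (q * \<bar>x\<bar>) ^ n" for n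
    using mult_right_mono[OF c, of "\<bar>x\<bar> ^ n" n]
    by (simp add: abs_mult power_abs power_mult_distrib mult_ac)
  ultimately show "summable (\<lambda>n. c n * x ^ n)" "\<bar>\<Sum>n. c n * x ^ n\<bar> \<le> K / (1 - q * \<bar>x\<bar>)"
    using summable_comparison_test'[OF _ le] norm_suminf_le[of "\<lambda>n. c n * x ^ n", OF le]
    by (auto simp: sums_iff)
qed

lemma conv_radius_geometric_majorant:
  fixes c :: "nat \<Rightarrow> real"
  assumes c: "\<And>n. \<bar>c n\<bar> \<le> K * q ^ n" and q: "q > 0"
  shows "conv_radius c \<ge> ereal (1 / q)"
  using q by (intro conv_radius_geI_ex' summable_geometric_majorant[OF c q]) (auto simp: field_simps)

text \<open>
  The derived series is dominated by \<open>K q \<Sum> (n+1) (q \<bar>x\<bar>)\<^sup>n\<close>, the derivative of the geometric series.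
\<close>

lemma deriv_geometric_majorant:
  fixes c :: "nat \<Rightarrow> real"
  assumes c: "\<And>n. \<bar>c n\<bar> \<le> K * q ^ n" and q: "q > 0" and x: "q * \<bar>x\<bar> < 1"
  obtains D where "((\<lambda>x. \<Sum>n. c n * x ^ n) has_real_derivative D) (at x)"
    and "\<bar>D\<bar> \<le> K * q / (1 - q * \<bar>x\<bar>)\<^sup>2"
proof
  show "((\<lambda>x. \<Sum>n. c n * x ^ n) has_real_derivative (\<Sum>n. diffs c n * x ^ n)) (at x)"
    using q x
    by (intro termdiffs_strong'[of "1 / q"] summable_geometric_majorant[OF c q])
      (auto simp: field_simps)
  have "(\<lambda>n. K * q * (real (Suc n) * (q * \<bar>x\<bar>) ^ n)) sums (K * q * (1 / (1 - q * \<bar>x\<bar>)\<^sup>2))"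
    using q x by (intro sums_mult geometric_deriv_sums) (auto simp: abs_mult)
  moreover have le: "norm (diffs c n * x ^ n) \<le> K * q * (real (Suc n) * (q * \<bar>x\<bar>) ^ n)" for n
    using mult_right_mono[OF c, of "real (Suc n) * \<bar>x\<bar> ^ n" "Suc n"]
    by (simp add: diffs_def abs_mult power_abs power_mult_distrib mult_ac)
  ultimately show "\<bar>\<Sum>n. diffs c n * x ^ n\<bar> \<le> K * q / (1 - q * \<bar>x\<bar>)\<^sup>2"
    using norm_suminf_le[of "\<lambda>n. diffs c n * x ^ n", OF le] by (auto simp: sums_iff)
qed

section \<open>Convergence and size of the reference temperature\<close>

theorem proposition2:
  fixes \<alpha> \<beta> \<epsilon> Tm d M R F G :: real
    and s :: "real \<Rightarrow> real"
    and a :: "nat \<Rightarrow> real \<Rightarrow> real"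
    and T :: "real \<Rightarrow> real \<Rightarrow> real"
  assumes "\<alpha> > 0" and "\<beta> > 0" and "\<epsilon> > 0"
    and "smooth_halfline s"
    and "1 \<le> d" and "d \<le> 2" and "M > 0" and "R > 0"
    and "\<forall>m::nat. \<forall>t\<ge>0. \<bar>(time_deriv ^^ (m + 1)) s t\<bar> \<le> M * (fact m powr d) / R ^ m"
  defines "F \<equiv> F_const \<alpha> M R" and "G \<equiv> G_const \<beta> \<epsilon> R"
    and "a \<equiv> series_coeff \<alpha> \<beta> \<epsilon> s" and "T \<equiv> T_ref \<alpha> \<beta> \<epsilon> Tm s"
  shows "(\<forall>t\<ge>0. conv_radius (\<lambda>n. a n t / fact n) \<ge> ereal (R / F)) \<and>
    (ereal R \<ge> ereal F * (SUP t\<in>{0..}. ereal \<bar>s t\<bar>) \<longrightarrow>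
      (\<forall>t\<ge>0. \<forall>x. 0 < x \<and> x < s t \<longrightarrow>
         summable (\<lambda>n. a n t / fact n * (x - s t) ^ n) \<and>
         \<bar>T x t - Tm\<bar> \<le> M * G * R / (F * (R - F * (s t - x))) \<and>
         (\<lambda>y. T y t) differentiable (at x) \<and>
         \<bar>deriv (\<lambda>y. T y t) x\<bar> \<le> M * G * R / (R - F * (s t - x))\<^sup>2))"
proof -
  have pos: "\<alpha> > 0" "\<beta> > 0" "\<epsilon> > 0" "M > 0" "R > 0"
    using assms by auto
  have F: "F > 0"
    using F_const_pos pos by (simp add: F_def)
  define K where "K = M * G / F"
  define c where "c = (\<lambda>t n. a n t / fact n)"
  have c: "\<bar>c t n\<bar> \<le> K * (F / R) ^ n" if "t \<ge> 0" for t n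
  proof -
    have "\<bar>(time_deriv ^^ 0) (series_coeff \<alpha> \<beta> \<epsilon> s n) t\<bar>
        \<le> M * G / F * F ^ n / R ^ (n + 0) * gevrey (d - 1) n 0"
      unfolding F_def G_def
      by (rule series_coeff_gevrey_bound) (use assms(1-9) that in auto)
    then have "\<bar>a n t\<bar> \<le> K * (F / R) ^ n * fact n"
      by (simp add: a_def K_def gevrey_0_right power_divide)
    then show ?thesis
      by (simp add: c_def field_simps)
  qed
  have conv: "conv_radius (c t) \<ge> ereal (R / F)" if "t \<ge> 0" for t
    using conv_radius_geometric_majorant[OF c[OF that]] F pos by simp
  have series: "summable (\<lambda>n. c t n * (x - s t) ^ n) \<and>
      \<bar>T x t - Tm\<bar> \<le> M * G * R / (F * (R - F * (s t - x))) \<and>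
      (\<lambda>y. T y t) differentiable (at x) \<and>
      \<bar>deriv (\<lambda>y. T y t) x\<bar> \<le> M * G * R / (R - F * (s t - x))\<^sup>2"
    if sup: "ereal R \<ge> ereal F * (SUP t\<in>{0..}. ereal \<bar>s t\<bar>)"
      and t: "t \<ge> 0" and x: "0 < x" "x < s t" for t x
  proof -
    have "ereal F * ereal \<bar>s t\<bar> \<le> ereal F * (SUP t\<in>{0..}. ereal \<bar>s t\<bar>)"
      using F t by (intro ereal_mult_left_mono SUP_upper) auto
    then have "F * s t \<le> R"
      using sup x by (metis abs_of_pos ereal_less_eq(3) order.strict_trans order_trans
          times_ereal.simps(1))
    \<comment> \<open>The hypothesis on the supremum is not strict; strictness comes from \<open>x > 0\<close>.\<close>
    then have small: "F * (s t - x) < R"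
      using mult_pos_pos[OF F x(1)] by (simp add: algebra_simps)
    have abs_y: "\<bar>x - s t\<bar> = s t - x"
      using x by simp
    have q: "F / R > 0" and y: "F / R * \<bar>x - s t\<bar> < 1"
      using F pos small unfolding abs_y by (auto simp: field_simps)
    have T_eq: "T y t = Tm + (\<Sum>n. c t n * (y - s t) ^ n)" for y
      by (simp add: T_def T_ref_def c_def a_def)
    have gap: "1 - F / R * \<bar>x - s t\<bar> = (R - F * (s t - x)) / R"
      unfolding abs_y using pos by (simp add: field_simps)
    have gap_pos: "R - F * (s t - x) > 0"
      using small by simp

    have "\<bar>T x t - Tm\<bar> \<le> K / ((R - F * (s t - x)) / R)"
      using suminf_geometric_majorant[OF c[OF t] q y] unfolding gap
      by (simp only: T_eq add_diff_cancel_left')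
    also have "\<dots> = M * G * R / (F * (R - F * (s t - x)))"
      by (simp add: K_def)
    finally have size: "\<bar>T x t - Tm\<bar> \<le> M * G * R / (F * (R - F * (s t - x)))" .

    obtain D where D: "((\<lambda>y. \<Sum>n. c t n * y ^ n) has_real_derivative D) (at (x - s t))"
      and D_le: "\<bar>D\<bar> \<le> K * (F / R) / (1 - F / R * \<bar>x - s t\<bar>)\<^sup>2"
      using deriv_geometric_majorant[OF c[OF t] q y] by blast
    have "((\<lambda>y. \<Sum>n. c t n * (y - s t) ^ n) has_real_derivative D) (at x)"
      by (rule DERIV_chain2[where g = "\<lambda>y. y - s t", OF D, THEN DERIV_cong])
        (auto intro!: derivative_eq_intros)
    then have T_deriv: "((\<lambda>y. T y t) has_real_derivative D) (at x)"
      unfolding T_eq by (auto intro!: derivative_eq_intros)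
    have "K * (F / R) / (1 - F / R * \<bar>x - s t\<bar>)\<^sup>2 = M * G * R / (R - F * (s t - x))\<^sup>2"
      unfolding gap K_def using F pos gap_pos by (simp add: power2_eq_square)
    then have "\<bar>deriv (\<lambda>y. T y t) x\<bar> \<le> M * G * R / (R - F * (s t - x))\<^sup>2"
      using D_le DERIV_imp_deriv[OF T_deriv] by simp
    moreover have "(\<lambda>y. T y t) differentiable (at x)"
      using T_deriv real_differentiable_def by blast
    ultimately show ?thesis
      using summable_geometric_majorant[OF c[OF t] q y] size by blast
  qed
  show ?thesis
    using conv series unfolding c_def by blast
qed

end
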